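(* Let $m\ge 2$ be an integer, let $r>0$, $\mu>0$, and let $G^{(1)}_{r,\mu},G^{(2)}_{r,\mu},\ldots,G^{(m)}_{r,\mu}$ be independent random variables having the same gamma distribution with shape parameter $r$ and scale parameter $\mu$. Put $k=(m-1)r$ and $$R=\frac{G^{(1)}_{r,\mu}}{G^{(1)}_{r,\mu}+G^{(2)}_{r,\mu}+\ldots+G^{(m)}_{r,\mu}},\qquad R_0=\frac{(m-1)G^{(1)}_{r,\mu}}{G^{(2)}_{r,\mu}+\ldots+G^{(m)}_{r,\mu}}.$$ Then: (i) $R\stackrel{d}{=}\left(1+\frac{k}{r}Q_{k,r}\right)^{-1}$, and the distribution of $R$ is determined by the density $$p(x;k,r)=\frac{\Gamma(k+r)}{\Gamma(r)\Gamma(k)}(1-x)^{k-1}x^{r-1},\qquad 0\le x\le 1,$$ that is, $R$ has a beta distribution; (ii) $R_0\stackrel{d}{=}Q_{r,k}$, that is, $R_0$ has the Snedecor--Fisher distribution with parameters $r$ and $k=(m-1)r$; (iii) $R$ and $R_0$ are related by the one-to-one correspondence $$R=\frac{R_0}{m-1+R_0},\qquad R_0=\frac{(m-1)R}{1-R}.$$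
   Context: The symbol $\stackrel{d}{=}$ denotes equality in distribution. The gamma distribution with shape parameter $r>0$ and (rate-type) scale parameter $\mu>0$ has distribution function $\int_0^x\frac{\mu^r}{\Gamma(r)}z^{r-1}e^{-\mu z}\,dz$ for $x\ge0$. For $k>0$, $r>0$ (not necessarily integers), $Q_{k,r}$ denotes a random variable having the Snedecor--Fisher distribution with parameters $k$ and $r$, given by the Lebesgue density $$f_{k,r}(x)=\frac{\Gamma(k+r)}{\Gamma(k)\Gamma(r)}\Big(\frac{k}{r}\Big)^{k}\frac{x^{k-1}}{(1+\frac{k}{r}x)^{k+r}},\qquad x\ge 0.$$ In particular, $Q_{r,k}$ has density $f_{r,k}$, obtained by interchanging the roles of $k$ and $r$. *)

theory Defs
  imports "HOL-Probability.Probability"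
begin

definition gamma_pdf :: "real \<Rightarrow> real \<Rightarrow> real \<Rightarrow> real" where
  "gamma_pdf r \<mu> z = \<mu> powr r / Gamma r * z powr (r - 1) * exp (- \<mu> * z)"

text \<open>
  The gamma law is specified through its distribution function. For \<open>x < 0\<close> the interval
  \<open>{0..x}\<close> is empty, so the distribution function vanishes there.
\<close>

definition has_gamma_distribution :: "'a measure \<Rightarrow> ('a \<Rightarrow> real) \<Rightarrow> real \<Rightarrow> real \<Rightarrow> bool" where
  "has_gamma_distribution M X r \<mu> \<longleftrightarrow>
     X \<in> borel_measurable M \<and>
     (\<forall>x. cdf (distr M borel X) x = (LINT z:{0..x}|lborel. gamma_pdf r \<mu> z))"

definition snedecor_fisher_density :: "real \<Rightarrow> real \<Rightarrow> real \<Rightarrow> real" where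
  "snedecor_fisher_density k r x =
     (if x \<ge> 0
      then Gamma (k + r) / (Gamma k * Gamma r) * (k / r) powr k *
           (x powr (k - 1) / (1 + k / r * x) powr (k + r))
      else 0)"

definition has_snedecor_fisher_distribution ::
    "'a measure \<Rightarrow> ('a \<Rightarrow> real) \<Rightarrow> real \<Rightarrow> real \<Rightarrow> bool" where
  "has_snedecor_fisher_distribution M X k r \<longleftrightarrow>
     distributed M lborel X (\<lambda>x. ennreal (snedecor_fisher_density k r x))"

text \<open>
  The argument order follows the notation \<open>p(x; k, r)\<close>: the exponent of \<open>x\<close> is governed by the
  second parameter, so this is the beta law usually written \<open>Beta(r, k)\<close>.
\<close>

definition beta_density :: "real \<Rightarrow> real \<Rightarrow> real \<Rightarrow> real" where
  "beta_density k r x =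
     (if 0 \<le> x \<and> x \<le> 1
      then Gamma (k + r) / (Gamma r * Gamma k) * (1 - x) powr (k - 1) * x powr (r - 1)
      else 0)"

text \<open>
  The two random variables may live on different probability spaces. Measurability is included
  because \<open>distr\<close> is only meaningful for measurable functions.
\<close>

definition eq_in_distribution ::
    "'a measure \<Rightarrow> ('a \<Rightarrow> real) \<Rightarrow> 'b measure \<Rightarrow> ('b \<Rightarrow> real) \<Rightarrow> bool" where
  "eq_in_distribution M X N Y \<longleftrightarrow>
     X \<in> borel_measurable M \<and> Y \<in> borel_measurable N \<and> distr M borel X = distr N borel Y"

end

(* With X of shape r and S of shape k (the sum of the remaining variables), the substitution x = z u
   in the joint density of X and the total z = X + S splits it into a beta density in u times a gamma
   density in z; the substitution x = (r/k) s t in the joint density of X and S, followed by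
   integration over s, gives the Snedecor-Fisher density in t. *)

theory Submission
  imports Defs
begin

section \<open>The gamma density on the whole line\<close>

text \<open>The cut-off removes negative arguments, where \<open>powr\<close> is not a meaningful
  power. Because \<open>0 powr (r - 1) = 0\<close>, \<open>gamma_pdf\<close> vanishes at 0 as well,
  so the strict inequality agrees with integration over \<open>{0..x}\<close>.\<close>

definition gamma_density :: "real \<Rightarrow> real \<Rightarrow> real \<Rightarrow> real" where
  "gamma_density r \<mu> z = (if 0 < z then gamma_pdf r \<mu> z else 0)"

lemma gamma_density_nonneg [simp]: "r > 0 \<Longrightarrow> 0 \<le> gamma_density r \<mu> z"
  by (simp add: gamma_density_def gamma_pdf_def less_imp_le)

lemma borel_measurable_gamma_density [measurable]: "gamma_density r \<mu> \<in> borel_measurable borel"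
  unfolding gamma_density_def gamma_pdf_def by measurable

lemma borel_measurable_beta_density [measurable]: "beta_density b a \<in> borel_measurable borel"
  unfolding beta_density_def by measurable

lemma borel_measurable_snedecor_fisher_density [measurable]:
  "snedecor_fisher_density a b \<in> borel_measurable borel"
  unfolding snedecor_fisher_density_def by measurable

lemma beta_density_nonneg: "a > 0 \<Longrightarrow> b > 0 \<Longrightarrow> 0 \<le> beta_density b a x"
  by (simp add: beta_density_def less_imp_le)

lemma snedecor_fisher_density_nonneg:
  "a > 0 \<Longrightarrow> b > 0 \<Longrightarrow> 0 \<le> snedecor_fisher_density a b x"
  by (simp add: snedecor_fisher_density_def less_imp_le)

text \<open>The substitution t = \<mu> z reduces the total mass to the Euler integral for
  \<open>Gamma r\<close>.\<close>

lemma nn_integral_gamma_density: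
  assumes r: "r > 0" and \<mu>: "\<mu> > 0"
  shows "(\<integral>\<^sup>+z. ennreal (gamma_density r \<mu> z) \<partial>lborel) = 1"
proof -
  have G: "Gamma r > 0"
    using r by (rule Gamma_real_pos)
  \<comment> \<open>One factor \<open>\<mu>\<close> is split off from \<open>\<mu> powr r\<close> as
    the Jacobian of t = \<mu> z. The summand 0 keeps the integrand in the shape of the affine
    substitution rule.\<close>
  have eq: "gamma_density r \<mu> z =
      \<mu> / Gamma r * (indicator {0..} (0 + \<mu> * z) * (0 + \<mu> * z) powr (r - 1) / exp (0 + \<mu> * z))" for z
  proof (cases "0 < z")
    case True
    have "\<mu> powr r = \<mu> * \<mu> powr (r - 1)"
      using powr_add[of \<mu> 1 "r - 1"] \<mu> by simp
    then show ?thesis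
      using True \<mu> by (simp add: gamma_density_def gamma_pdf_def powr_mult exp_minus field_simps)
  next
    case False
    then show ?thesis
      using \<mu> by (cases "z = 0") (auto simp: gamma_density_def indicator_def zero_le_mult_iff)
  qed
  let ?f = "\<lambda>t::real. indicator {0..} t * t powr (r - 1) / exp t"
  have "(\<integral>\<^sup>+z. ennreal (gamma_density r \<mu> z) \<partial>lborel) =
      (\<integral>\<^sup>+z. ennreal (1 / Gamma r) * (ennreal \<bar>\<mu>\<bar> * ennreal (?f (0 + \<mu> * z))) \<partial>lborel)"
    unfolding eq using \<mu> G
    by (intro nn_integral_cong) (simp add: ennreal_mult[symmetric] field_simps)
  also have "\<dots> = ennreal (1 / Gamma r) * (ennreal \<bar>\<mu>\<bar> * (\<integral>\<^sup>+z. ennreal (?f (0 + \<mu> * z)) \<partial>lborel))"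
    by (simp add: nn_integral_cmult)
  also have "\<dots> = ennreal (1 / Gamma r) * (\<integral>\<^sup>+t. ennreal (?f t) \<partial>lborel)"
    by (subst nn_integral_real_affine[of "\<lambda>t. ennreal (?f t)" \<mu> 0]) (use \<mu> in auto)
  also have "\<dots> = ennreal (1 / Gamma r) * ennreal (Gamma r)"
    using Gamma_conv_nn_integral_real[OF r] by simp
  also have "\<dots> = 1"
    using G by (simp add: ennreal_mult[symmetric])
  finally show ?thesis .
qed

text \<open>Links the Lebesgue integral in \<open>has_gamma_distribution\<close> with the
  nonnegative integral used for densities; the finite total mass gives the integrability under which
  the two agree.\<close>

lemma nn_integral_gamma_density_atMost:
  assumes r: "r > 0" and \<mu>: "\<mu> > 0"
  shows "(\<integral>\<^sup>+z. ennreal (gamma_density r \<mu> z * indicator {..x} z) \<partial>lborel) =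
    ennreal (LINT z:{0..x}|lborel. gamma_pdf r \<mu> z)"
proof -
  have eq: "gamma_density r \<mu> z * indicator {..x} z = indicator {0..x} z * gamma_pdf r \<mu> z" for z
    by (cases "z = 0") (auto simp: gamma_density_def gamma_pdf_def indicator_def)
  have "integrable lborel (gamma_density r \<mu>)"
    using nn_integral_gamma_density[OF assms] r by (intro integrableI_nonneg) auto
  then have "integrable lborel (\<lambda>z. gamma_density r \<mu> z * indicator {..x} z)"
    by (rule integrable_real_mult_indicator[rotated]) simp
  then show ?thesis
    using r unfolding set_lebesgue_integral_def real_scaleR_def eq[symmetric]
    by (simp add: nn_integral_eq_integral)
qed

text \<open>A probability law on the line is determined by its values on the half-lines
  \<open>{..x}\<close>, so the distribution function already yields the density.\<close>

lemma (in prob_space) has_gamma_distribution_imp_distributed: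
  assumes r: "r > 0" and \<mu>: "\<mu> > 0" and X: "has_gamma_distribution M X r \<mu>"
  shows "distributed M lborel X (gamma_density r \<mu>)"
proof (rule distributedI_borel_atMost)
  show [measurable]: "X \<in> borel_measurable M"
    using X by (simp add: has_gamma_distribution_def)
  show "(\<integral>\<^sup>+z. ennreal (gamma_density r \<mu> z * indicator {..x} z) \<partial>lborel) =
      ennreal (LINT z:{0..x}|lborel. gamma_pdf r \<mu> z)" for x
    using r \<mu> by (rule nn_integral_gamma_density_atMost)
  show "emeasure M {\<omega>\<in>space M. X \<omega> \<le> x} = ennreal (LINT z:{0..x}|lborel. gamma_pdf r \<mu> z)" for x
  proof -
    have "{\<omega>\<in>space M. X \<omega> \<le> x} = X -` {..x} \<inter> space M"
      by auto
    then show ?thesis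
      using X by (simp add: has_gamma_distribution_def cdf_def measure_distr emeasure_eq_measure)
  qed
qed (use r in auto)

section \<open>Densities by testing against indicators, and independence\<close>

text \<open>Turns the search for a density into the evaluation of one nonnegative integral, where
  changes of variables and Fubini apply.\<close>

lemma distributed_lborelI:
  fixes Y :: "'a \<Rightarrow> real"
  assumes [measurable]: "Y \<in> borel_measurable M" "f \<in> borel_measurable borel"
    and eq: "\<And>A. A \<in> sets borel \<Longrightarrow>
      (\<integral>\<^sup>+\<omega>. indicator A (Y \<omega>) \<partial>M) = (\<integral>\<^sup>+y. indicator A y * f y \<partial>lborel)"
  shows "distributed M lborel Y f"
  unfolding distributed_def
proof safe
  show "distr M lborel Y = density lborel f"
  proof (rule measure_eqI)
    fix A assume "A \<in> sets (distr M lborel Y)"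
    then have A [measurable]: "A \<in> sets borel"
      by simp
    have "emeasure (distr M lborel Y) A = (\<integral>\<^sup>+\<omega>. indicator A (Y \<omega>) \<partial>M)"
      by (subst nn_integral_indicator[symmetric]) (auto simp: nn_integral_distr simp del: nn_integral_indicator)
    then show "emeasure (distr M lborel Y) A = emeasure (density lborel f) A"
      using eq[OF A] by (simp add: emeasure_density mult.commute)
  qed simp
qed simp_all

text \<open>Allows the ratio law to be applied to S / X as well as to X / S.\<close>

lemma (in prob_space) indep_var_sym:
  assumes "indep_var S X T Y"
  shows "indep_var T Y S X"
  using assms unfolding indep_var_eq indep_sets2_eq
proof (elim conjE, intro conjI ballI)
  fix B A
  let ?sigma = "\<lambda>Z U. sigma_sets (space M) {Z -` A \<inter> space M |A. A \<in> sets U}"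
  assume "\<forall>A\<in>?sigma X S. \<forall>B\<in>?sigma Y T. prob (A \<inter> B) = prob A * prob B"
    and "B \<in> ?sigma Y T" "A \<in> ?sigma X S"
  then have "prob (A \<inter> B) = prob A * prob B"
    by blast
  then show "prob (B \<inter> A) = prob B * prob A"
    by (simp only: Int_commute mult.commute)
qed

text \<open>Under independence the joint density is the product of the marginal ones, and Tonelli's
  theorem makes the integral iterated.\<close>

lemma (in prob_space) nn_integral_indep_var:
  fixes X S :: "'a \<Rightarrow> real"
  assumes X: "distributed M lborel X f" and S: "distributed M lborel S g"
    and indep: "indep_var borel X borel S"
    and [measurable]: "h \<in> borel_measurable (borel \<Otimes>\<^sub>M borel)"
  shows "(\<integral>\<^sup>+\<omega>. h (X \<omega>, S \<omega>) \<partial>M) = (\<integral>\<^sup>+x. \<integral>\<^sup>+s. f x * g s * h (x, s) \<partial>lborel \<partial>lborel)"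
proof -
  have [measurable]: "f \<in> borel_measurable borel" "g \<in> borel_measurable borel"
    using distributed_borel_measurable[OF X] distributed_borel_measurable[OF S] by simp_all
  \<comment> \<open>Independence depends on the target measures only through their measurable sets,
    and those of \<open>lborel\<close> and \<open>borel\<close> coincide.\<close>
  have indep': "indep_var lborel X lborel S"
    using indep by (simp add: indep_var_def indep_vars_def bool.case_eq_if cong: if_cong)
  have XS: "distributed M (lborel \<Otimes>\<^sub>M lborel) (\<lambda>\<omega>. (X \<omega>, S \<omega>)) (\<lambda>(x, s). f x * g s)"
    by (rule distributed_joint_indep[OF _ _ X S indep']) (simp_all add: sigma_finite_lborel)
  have h: "h \<in> borel_measurable (lborel \<Otimes>\<^sub>M lborel)"
    by simp
  show ?thesis
    unfolding distributed_nn_integral[OF XS h, symmetric]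
    by (subst lborel.nn_integral_fst[symmetric]) simp_all
qed

section \<open>Proportion and total of two independent gamma variables\<close>

text \<open>The leading z is the Jacobian of x = z u. The exponentials multiply to one free of u,
  the powers of z collect to \<open>z powr (a + b - 1)\<close>, and \<open>Gamma (a + b)\<close> is
  inserted to normalise both factors.\<close>

lemma gamma_density_mult_eq_beta_gamma:
  assumes "a > 0" "b > 0" and z: "z > 0"
  shows "z * (gamma_density a \<mu> (z * u) * gamma_density b \<mu> (z - z * u)) =
    beta_density b a u * gamma_density (a + b) \<mu> z"
proof -
  consider "u < 0 \<or> u > 1" | "u = 0 \<or> u = 1" | "0 < u" "u < 1"
    by linarith
  then show ?thesis
  proof cases
    case 1
    then have "z * u < 0 \<or> z - z * u < 0"
      using z by (auto simp: mult_less_0_iff)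
    with 1 show ?thesis
      by (auto simp: gamma_density_def beta_density_def)
  next
    \<comment> \<open>At the endpoints one gamma factor is evaluated at 0 and vanishes, while the
      beta density vanishes because \<open>0 powr y = 0\<close> for every y.\<close>
    case 2
    then show ?thesis
      by (auto simp: gamma_density_def beta_density_def)
  next
    case 3
    have zu: "z - z * u = z * (1 - u)" "z * (1 - u) > 0"
      using 3 z by (simp_all add: algebra_simps)
    have e: "exp (- \<mu> * (z * u)) * exp (- \<mu> * (z * (1 - u))) = exp (- \<mu> * z)"
      by (simp add: exp_add[symmetric] algebra_simps)
    have p: "z powr (a + b - 1) = z * z powr (a - 1) * z powr (b - 1)"
      using z powr_add[of z "a - 1" "b - 1"] powr_add[of z 1 "a + b - 2"]
      by (simp add: algebra_simps)
    have "Gamma (a + b) > 0"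
      using assms by (intro Gamma_real_pos) simp
    moreover have "z * (gamma_density a \<mu> (z * u) * gamma_density b \<mu> (z - z * u)) =
        \<mu> powr a * \<mu> powr b / (Gamma a * Gamma b) * (u powr (a - 1) * (1 - u) powr (b - 1)) *
        (z * z powr (a - 1) * z powr (b - 1)) *
        (exp (- \<mu> * (z * u)) * exp (- \<mu> * (z * (1 - u))))"
      using 3 z zu by (simp add: gamma_density_def gamma_pdf_def powr_mult)
    moreover have "beta_density b a u * gamma_density (a + b) \<mu> z =
        Gamma (a + b) / (Gamma a * Gamma b) * (1 - u) powr (b - 1) * u powr (a - 1) *
        (\<mu> powr a * \<mu> powr b / Gamma (a + b) * z powr (a + b - 1) * exp (- \<mu> * z))"
      using 3 z by (simp add: gamma_density_def gamma_pdf_def beta_density_def powr_add add.commute)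
    ultimately show ?thesis
      unfolding e p[symmetric] by simp
  qed
qed

text \<open>Lukacs' factorisation: the proportion \<open>X / (X + S)\<close> and the total \<open>X + S\<close> are
  independent, which yields the beta law of the former and the gamma law of the latter at once.\<close>

lemma (in prob_space) nn_integral_gamma_proportion_total:
  assumes a: "a > 0" and b: "b > 0"
    and X: "distributed M lborel X (gamma_density a \<mu>)"
    and S: "distributed M lborel S (gamma_density b \<mu>)"
    and indep: "indep_var borel X borel S"
    and [measurable]: "F \<in> borel_measurable (borel \<Otimes>\<^sub>M borel)"
  shows "(\<integral>\<^sup>+\<omega>. F (X \<omega> / (X \<omega> + S \<omega>), X \<omega> + S \<omega>) \<partial>M) =
    (\<integral>\<^sup>+z. \<integral>\<^sup>+u. ennreal (beta_density b a u) * ennreal (gamma_density (a + b) \<mu> z) * F (u, z)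
      \<partial>lborel \<partial>lborel)"
proof -
  let ?f = "\<lambda>x s. ennreal (gamma_density a \<mu> x) * ennreal (gamma_density b \<mu> s)"
  have "(\<integral>\<^sup>+\<omega>. F (X \<omega> / (X \<omega> + S \<omega>), X \<omega> + S \<omega>) \<partial>M) =
      (\<integral>\<^sup>+x. \<integral>\<^sup>+s. ?f x s * F (x / (x + s), x + s) \<partial>lborel \<partial>lborel)"
    using nn_integral_indep_var[OF X S indep, of "\<lambda>(x, s). F (x / (x + s), x + s)"] by simp
  \<comment> \<open>For fixed x the translation z = x + s makes the total an integration
    variable.\<close>
  also have "\<dots> = (\<integral>\<^sup>+x. \<integral>\<^sup>+z. ?f x (z - x) * F (x / z, z) \<partial>lborel \<partial>lborel)"
  proof (rule nn_integral_cong)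
    fix x :: real
    show "(\<integral>\<^sup>+s. ?f x s * F (x / (x + s), x + s) \<partial>lborel) = (\<integral>\<^sup>+z. ?f x (z - x) * F (x / z, z) \<partial>lborel)"
      by (subst (2) nn_integral_real_affine[of _ 1 x]) simp_all
  qed
  also have "\<dots> = (\<integral>\<^sup>+z. \<integral>\<^sup>+x. ?f x (z - x) * F (x / z, z) \<partial>lborel \<partial>lborel)"
    by (rule lborel_pair.Fubini'[symmetric]) simp
  also have "\<dots> = (\<integral>\<^sup>+z. \<integral>\<^sup>+u. ennreal (beta_density b a u) * ennreal (gamma_density (a + b) \<mu> z) *
      F (u, z) \<partial>lborel \<partial>lborel)"
  proof (rule nn_integral_cong)
    fix z :: real
    show "(\<integral>\<^sup>+x. ?f x (z - x) * F (x / z, z) \<partial>lborel) =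
        (\<integral>\<^sup>+u. ennreal (beta_density b a u) * ennreal (gamma_density (a + b) \<mu> z) * F (u, z) \<partial>lborel)"
    proof (cases "z > 0")
      case True
      have "(\<integral>\<^sup>+x. ?f x (z - x) * F (x / z, z) \<partial>lborel) =
          (\<integral>\<^sup>+u. ennreal z * (?f (z * u) (z - z * u) * F (u, z)) \<partial>lborel)"
        using True by (subst nn_integral_real_affine[of _ z 0]) (simp_all add: nn_integral_cmult)
      also have "\<dots> = (\<integral>\<^sup>+u. ennreal (z * (gamma_density a \<mu> (z * u) * gamma_density b \<mu> (z - z * u))) *
          F (u, z) \<partial>lborel)"
        using a b True by (intro nn_integral_cong) (simp add: ennreal_mult mult.assoc)
      finally show ?thesis
        using a b True
        by (simp add: gamma_density_mult_eq_beta_gamma beta_density_nonneg ennreal_mult)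
    next
      \<comment> \<open>Since x and z - x cannot both be positive when z \<le> 0, the product of the
        densities is 0 for every x, whatever value F takes at \<open>x / z\<close>.\<close>
      case False
      then have "gamma_density a \<mu> x = 0 \<or> gamma_density b \<mu> (z - x) = 0" for x
        by (auto simp: gamma_density_def)
      then have "?f x (z - x) = 0" for x
        by (metis ennreal_0 mult_zero_left mult_zero_right)
      then show ?thesis
        using False by (simp only: gamma_density_def[of "a + b"]) simp
    qed
  qed
  finally show ?thesis .
qed

text \<open>The factorisation is tested with a function of the proportion alone; the gamma density
  of the total then integrates to 1.\<close>

lemma (in prob_space) distributed_gamma_proportion:
  assumes a: "a > 0" and b: "b > 0" and \<mu>: "\<mu> > 0"
    and X: "distributed M lborel X (gamma_density a \<mu>)"
    and S: "distributed M lborel S (gamma_density b \<mu>)"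
    and indep: "indep_var borel X borel S"
  shows "distributed M lborel (\<lambda>\<omega>. X \<omega> / (X \<omega> + S \<omega>)) (beta_density b a)"
proof (rule distributed_lborelI)
  have [measurable]: "X \<in> borel_measurable M" "S \<in> borel_measurable M"
    using distributed_measurable[OF X] distributed_measurable[OF S] by simp_all
  show "(\<lambda>\<omega>. X \<omega> / (X \<omega> + S \<omega>)) \<in> borel_measurable M"
    by simp
  fix A :: "real set" assume [measurable]: "A \<in> sets borel"
  have "(\<integral>\<^sup>+\<omega>. indicator A (X \<omega> / (X \<omega> + S \<omega>)) \<partial>M) =
      (\<integral>\<^sup>+z. \<integral>\<^sup>+u. ennreal (gamma_density (a + b) \<mu> z) * (indicator A u * ennreal (beta_density b a u))
        \<partial>lborel \<partial>lborel)"
    using nn_integral_gamma_proportion_total[OF a b X S indep, of "\<lambda>(u, z). indicator A u"]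
    by (simp add: mult_ac)
  also have "\<dots> = (\<integral>\<^sup>+z. ennreal (gamma_density (a + b) \<mu> z) \<partial>lborel) *
      (\<integral>\<^sup>+u. indicator A u * ennreal (beta_density b a u) \<partial>lborel)"
    by (simp add: nn_integral_cmult nn_integral_multc)
  finally show "(\<integral>\<^sup>+\<omega>. indicator A (X \<omega> / (X \<omega> + S \<omega>)) \<partial>M) =
      (\<integral>\<^sup>+u. indicator A u * ennreal (beta_density b a u) \<partial>lborel)"
    using a b \<mu> by (simp add: nn_integral_gamma_density)
qed simp

text \<open>Dually, a test function of the total alone leaves the mass of the beta density as a
  factor.\<close>

lemma (in prob_space) distributed_gamma_add:
  assumes a: "a > 0" and b: "b > 0" and \<mu>: "\<mu> > 0"
    and X: "distributed M lborel X (gamma_density a \<mu>)"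
    and S: "distributed M lborel S (gamma_density b \<mu>)"
    and indep: "indep_var borel X borel S"
  shows "distributed M lborel (\<lambda>\<omega>. X \<omega> + S \<omega>) (gamma_density (a + b) \<mu>)"
proof (rule distributed_lborelI)
  have [measurable]: "X \<in> borel_measurable M" "S \<in> borel_measurable M"
    using distributed_measurable[OF X] distributed_measurable[OF S] by simp_all
  show "(\<lambda>\<omega>. X \<omega> + S \<omega>) \<in> borel_measurable M"
    by simp
  \<comment> \<open>The beta density has mass 1 because it is the density of an actual random
    variable, the proportion; the beta integral is thus obtained without evaluating it.\<close>
  interpret beta: prob_space "density lborel (beta_density b a)"
    using distributed_gamma_proportion[OF assms]
    by (simp add: distributed_distr_eq_density[symmetric] prob_space_distr)
  have mass: "(\<integral>\<^sup>+u. ennreal (beta_density b a u) \<partial>lborel) = 1"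
    using beta.emeasure_space_1 by (simp add: emeasure_density)
  fix A :: "real set" assume [measurable]: "A \<in> sets borel"
  have "(\<integral>\<^sup>+\<omega>. indicator A (X \<omega> + S \<omega>) \<partial>M) =
      (\<integral>\<^sup>+z. \<integral>\<^sup>+u. ennreal (beta_density b a u) * (indicator A z * ennreal (gamma_density (a + b) \<mu> z))
        \<partial>lborel \<partial>lborel)"
    using nn_integral_gamma_proportion_total[OF a b X S indep, of "\<lambda>(u, z). indicator A z"]
    by (simp add: mult_ac)
  then show "(\<integral>\<^sup>+\<omega>. indicator A (X \<omega> + S \<omega>) \<partial>M) =
      (\<integral>\<^sup>+z. indicator A z * ennreal (gamma_density (a + b) \<mu> z) \<partial>lborel)"
    by (simp add: nn_integral_multc mass)
qed simp

text \<open>Induction on the index set: the new variable is independent of the sum of the others,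
  and shapes add at equal rate.\<close>

lemma (in prob_space) distributed_gamma_sum:
  fixes G :: "'i \<Rightarrow> 'a \<Rightarrow> real"
  assumes "finite I" "I \<noteq> {}" and r: "r > 0" and \<mu>: "\<mu> > 0"
    and "\<And>i. i \<in> I \<Longrightarrow> distributed M lborel (G i) (gamma_density r \<mu>)"
    and "indep_vars (\<lambda>_. borel) G I"
  shows "distributed M lborel (\<lambda>\<omega>. \<Sum>i\<in>I. G i \<omega>) (gamma_density (real (card I) * r) \<mu>)"
  using assms(1,2,5,6)
proof (induction rule: finite_ne_induct)
  \<comment> \<open>The induction starts from one variable, since the empty sum is constantly 0 and
    has no density.\<close>
  case (singleton i)
  then show ?case by simp
next
  case (insert i I)
  have "distributed M lborel (\<lambda>\<omega>. G i \<omega> + (\<Sum>i\<in>I. G i \<omega>)) (gamma_density (r + real (card I) * r) \<mu>)"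
  proof (rule distributed_gamma_add)
    show "indep_var borel (G i) borel (\<lambda>\<omega>. \<Sum>i\<in>I. G i \<omega>)"
      using insert by (intro indep_vars_sum) auto
    show "distributed M lborel (\<lambda>\<omega>. \<Sum>i\<in>I. G i \<omega>) (gamma_density (real (card I) * r) \<mu>)"
      using insert by (auto intro: indep_vars_subset)
  qed (use insert r \<mu> in \<open>auto simp: card_gt_0_iff\<close>)
  moreover have "r + real (card I) * r = real (card (insert i I)) * r"
    using insert by (simp add: algebra_simps)
  ultimately show ?case
    using insert by simp
qed

section \<open>Ratio of two independent gamma variables\<close>

text \<open>The factor \<open>a / b * s\<close> is the Jacobian of x = (a / b) s t. The exponentials
  merge into one with rate \<open>\<mu> * (1 + a / b * t)\<close>, so that for fixed t the
  dependence on s is that of a gamma density of shape \<open>a + b\<close>.\<close>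

lemma gamma_density_mult_eq_snedecor_fisher_gamma:
  assumes a: "a > 0" and b: "b > 0" and \<mu>: "\<mu> > 0" and s: "s > 0" and t: "t > 0"
  shows "a / b * s * (gamma_density a \<mu> (a / b * s * t) * gamma_density b \<mu> s) =
    snedecor_fisher_density a b t * gamma_density (a + b) (\<mu> * (1 + a / b * t)) s"
proof -
  define c where "c = a / b"
  have c: "c > 0"
    using a b by (simp add: c_def)
  have ct: "1 + c * t > 0"
    using c t by (simp add: add_pos_pos)
  have e: "exp (- \<mu> * (c * s * t)) * exp (- \<mu> * s) = exp (- (\<mu> * (1 + c * t)) * s)"
    by (simp add: exp_add[symmetric] algebra_simps)
  have p: "s powr (a + b - 1) = s * s powr (a - 1) * s powr (b - 1)"
    using s powr_add[of s "a - 1" "b - 1"] powr_add[of s 1 "a + b - 2"]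
    by (simp add: algebra_simps)
  have q: "c powr a = c * c powr (a - 1)"
    using c powr_add[of c 1 "a - 1"] by simp
  have G: "Gamma (a + b) > 0"
    using a b by (intro Gamma_real_pos) simp
  have "c * s * (gamma_density a \<mu> (c * s * t) * gamma_density b \<mu> s) =
      \<mu> powr a * \<mu> powr b / (Gamma a * Gamma b) * (c * c powr (a - 1)) * t powr (a - 1) *
      (s * s powr (a - 1) * s powr (b - 1)) * (exp (- \<mu> * (c * s * t)) * exp (- \<mu> * s))"
    using c s t by (simp add: gamma_density_def gamma_pdf_def powr_mult)
  \<comment> \<open>Multiplying and dividing by \<open>Gamma (a + b)\<close> and
    \<open>(1 + c * t) powr (a + b)\<close> normalises the part depending on s.\<close>
  also have "\<dots> = Gamma (a + b) / (Gamma a * Gamma b) * c powr a *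
      (t powr (a - 1) / (1 + c * t) powr (a + b)) *
      ((\<mu> * (1 + c * t)) powr (a + b) / Gamma (a + b) * s powr (a + b - 1) *
        exp (- (\<mu> * (1 + c * t)) * s))"
    unfolding e p[symmetric] q[symmetric] using G ct \<mu>
    by (simp add: powr_mult powr_add)
  finally show ?thesis
    using s t by (simp add: gamma_density_def gamma_pdf_def snedecor_fisher_density_def c_def)
qed

text \<open>The variable is (X / a) / (S / b). After the substitution the order of integration is
  exchanged, and for t > 0 the inner integral over s is the mass 1 of a gamma density with rate
  depending on t.\<close>

lemma (in prob_space) distributed_gamma_ratio:
  assumes a: "a > 0" and b: "b > 0" and \<mu>: "\<mu> > 0"
    and X: "distributed M lborel X (gamma_density a \<mu>)"
    and S: "distributed M lborel S (gamma_density b \<mu>)"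
    and indep: "indep_var borel X borel S"
  shows "distributed M lborel (\<lambda>\<omega>. b / a * (X \<omega> / S \<omega>)) (snedecor_fisher_density a b)"
proof (rule distributed_lborelI)
  have [measurable]: "X \<in> borel_measurable M" "S \<in> borel_measurable M"
    using distributed_measurable[OF X] distributed_measurable[OF S] by simp_all
  show "(\<lambda>\<omega>. b / a * (X \<omega> / S \<omega>)) \<in> borel_measurable M"
    by simp
  fix A :: "real set" assume [measurable]: "A \<in> sets borel"
  let ?F = "\<lambda>x. indicator A x :: ennreal"
  let ?h = "\<lambda>s t. ennreal (a / b * s * (gamma_density a \<mu> (a / b * s * t) * gamma_density b \<mu> s))"
  have "(\<integral>\<^sup>+\<omega>. ?F (b / a * (X \<omega> / S \<omega>)) \<partial>M) =
      (\<integral>\<^sup>+x. \<integral>\<^sup>+s. ennreal (gamma_density a \<mu> x) * ennreal (gamma_density b \<mu> s) *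
        ?F (b / a * (x / s)) \<partial>lborel \<partial>lborel)"
    using nn_integral_indep_var[OF X S indep, of "\<lambda>(x, s). ?F (b / a * (x / s))"] by simp
  also have "\<dots> = (\<integral>\<^sup>+s. \<integral>\<^sup>+x. ennreal (gamma_density a \<mu> x) * ennreal (gamma_density b \<mu> s) *
        ?F (b / a * (x / s)) \<partial>lborel \<partial>lborel)"
    by (rule lborel_pair.Fubini'[symmetric]) simp
  \<comment> \<open>For fixed s > 0 substitute x = (a / b) s t: \<open>?h\<close> absorbs the
    Jacobian and the argument of \<open>?F\<close> becomes t. For s \<le> 0 the density of S is
    0.\<close>
  also have "\<dots> = (\<integral>\<^sup>+s. \<integral>\<^sup>+t. ?h s t * ?F t \<partial>lborel \<partial>lborel)"
  proof (rule nn_integral_cong)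
    fix s :: real
    show "(\<integral>\<^sup>+x. ennreal (gamma_density a \<mu> x) * ennreal (gamma_density b \<mu> s) *
        ?F (b / a * (x / s)) \<partial>lborel) = (\<integral>\<^sup>+t. ?h s t * ?F t \<partial>lborel)"
    proof (cases "s > 0")
      case True
      then have c: "a / b * s > 0"
        using a b by simp
      have "(\<integral>\<^sup>+x. ennreal (gamma_density a \<mu> x) * ennreal (gamma_density b \<mu> s) *
          ?F (b / a * (x / s)) \<partial>lborel) =
          ennreal (a / b * s) * (\<integral>\<^sup>+t. ennreal (gamma_density a \<mu> (a / b * s * t)) *
            ennreal (gamma_density b \<mu> s) * ?F t \<partial>lborel)"
        using a b True c by (subst nn_integral_real_affine[of _ "a / b * s" 0]) simp_all
      also have "\<dots> = (\<integral>\<^sup>+t. ennreal (a / b * s) * (ennreal (gamma_density a \<mu> (a / b * s * t)) *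
            ennreal (gamma_density b \<mu> s) * ?F t) \<partial>lborel)"
        by (rule nn_integral_cmult[symmetric]) simp
      also have "\<dots> = (\<integral>\<^sup>+t. ?h s t * ?F t \<partial>lborel)"
        unfolding ennreal_mult'[OF less_imp_le[OF c]] ennreal_mult'[OF gamma_density_nonneg[OF a]]
        by (simp only: mult.assoc)
      finally show ?thesis .
    qed (simp add: gamma_density_def)
  qed
  also have "\<dots> = (\<integral>\<^sup>+t. \<integral>\<^sup>+s. ?h s t * ?F t \<partial>lborel \<partial>lborel)"
    by (rule lborel_pair.Fubini') simp
  also have "\<dots> = (\<integral>\<^sup>+t. ?F t * ennreal (snedecor_fisher_density a b t) \<partial>lborel)"
  proof (rule nn_integral_cong)
    fix t :: real
    show "(\<integral>\<^sup>+s. ?h s t * ?F t \<partial>lborel) = ?F t * ennreal (snedecor_fisher_density a b t)"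
    proof (cases "t > 0")
      case True
      have h: "?h s t = ennreal (snedecor_fisher_density a b t) *
          ennreal (gamma_density (a + b) (\<mu> * (1 + a / b * t)) s)" for s
      proof (cases "s > 0")
        case s: True
        show ?thesis
          unfolding gamma_density_mult_eq_snedecor_fisher_gamma[OF a b \<mu> s True]
          using a b by (simp add: ennreal_mult snedecor_fisher_density_nonneg)
      qed (simp add: gamma_density_def)
      have "\<mu> * (1 + a / b * t) > 0"
        using a b \<mu> True by (simp add: add_pos_pos)
      then show ?thesis
        unfolding h using a b
        by (simp add: nn_integral_multc nn_integral_cmult nn_integral_gamma_density mult.commute)
    next
      \<comment> \<open>For t \<le> 0 both sides vanish: s and \<open>a / b * s * t\<close> are
        never both positive, and at t = 0 the Snedecor-Fisher density is 0 because
        \<open>0 powr (a - 1) = 0\<close>.\<close>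
      case False
      have h: "?h s t = 0" for s
      proof (cases "s > 0")
        case True
        then have "a / b * s * t \<le> 0"
          using False a b by (intro mult_nonneg_nonpos) simp_all
        then show ?thesis
          by (simp add: gamma_density_def)
      qed (simp add: gamma_density_def)
      have "snedecor_fisher_density a b t = 0"
        using False by (auto simp: snedecor_fisher_density_def)
      then show ?thesis
        unfolding h by simp
    qed
  qed
  finally show "(\<integral>\<^sup>+\<omega>. ?F (b / a * (X \<omega> / S \<omega>)) \<partial>M) =
      (\<integral>\<^sup>+t. ?F t * ennreal (snedecor_fisher_density a b t) \<partial>lborel)" .
qed simp

section \<open>Almost sure positivity, equality of laws and the correspondence\<close>

text \<open>The density vanishes off the positive axis. This discards the points at which
  denominators could be 0.\<close>

lemma AE_pos_of_distributed_gamma_density: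
  assumes X: "distributed M lborel X (gamma_density r \<mu>)"
  shows "AE \<omega> in M. 0 < X \<omega>"
proof -
  have [measurable]: "X \<in> borel_measurable M"
    using distributed_measurable[OF X] by simp
  have "AE x in density lborel (gamma_density r \<mu>). 0 < x"
    by (subst AE_density, measurable) (simp add: gamma_density_def)
  then have "AE x in distr M lborel X. 0 < x"
    by (simp only: distributed_distr_eq_density[OF X])
  then show ?thesis
    by (subst (asm) AE_distr_iff) simp_all
qed

text \<open>Bridges the target \<open>lborel\<close> of \<open>distributed\<close> and the target
  \<open>borel\<close> of \<open>eq_in_distribution\<close>; the image measure only sees their
  common measurable sets.\<close>

lemma distributed_eq_distr_borel:
  fixes X :: "'a \<Rightarrow> real" and Y :: "'b \<Rightarrow> real"
  assumes X: "distributed M lborel X f" and Y: "distributed N lborel Y f"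
  shows "distr M borel X = distr N borel Y"
proof -
  have "distr M borel X = distr M lborel X" "distr N borel Y = distr N lborel Y"
    by (simp_all cong: distr_cong)
  then show ?thesis
    using distributed_distr_eq_density[OF X] distributed_distr_eq_density[OF Y] by simp
qed

text \<open>Both denominators are positive, and cross-multiplication turns either equation into c x
  = y (1 - x).\<close>

lemma ratio_proportion_iff:
  fixes c x y :: real
  assumes "c > 0" "y > 0" "x < 1"
  shows "x = y / (c + y) \<longleftrightarrow> y = c * x / (1 - x)"
  using assms by (auto simp: field_simps add_pos_pos)

text \<open>The explicit inverse is the other formula; each composition is the preceding equivalence
  with one variable replaced by its value.\<close>

lemma bij_betw_ratio_proportion:
  fixes c :: real
  assumes c: "c > 0"
  shows "bij_betw (\<lambda>y. y / (c + y)) {0<..} {0<..<1}"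
proof (rule bij_betw_byWitness[where f' = "\<lambda>x. c * x / (1 - x)"])
  show "\<forall>y\<in>{0<..}. c * (y / (c + y)) / (1 - y / (c + y)) = y"
  proof
    fix y :: real assume "y \<in> {0<..}"
    then have "y > 0" "y / (c + y) < 1"
      using c by (simp_all add: add_pos_pos)
    then show "c * (y / (c + y)) / (1 - y / (c + y)) = y"
      using ratio_proportion_iff[OF c] by metis
  qed
  show "\<forall>x\<in>{0<..<1}. c * x / (1 - x) / (c + c * x / (1 - x)) = x"
  proof
    fix x :: real assume "x \<in> {0<..<1}"
    then have "c * x / (1 - x) > 0" "x < 1"
      using c by simp_all
    then show "c * x / (1 - x) / (c + c * x / (1 - x)) = x"
      using ratio_proportion_iff[OF c] by metis
  qed
qed (use c in \<open>auto simp: add_pos_pos\<close>)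

section \<open>Assembly of the three claims\<close>

text \<open>The identities in (iii) are asserted almost surely: where the sum over
  \<open>{2..m}\<close> is 0 and \<open>G 1 \<omega> > 0\<close>, the convention
  \<open>x / 0 = 0\<close> gives \<open>R \<omega> = 1\<close> and
  \<open>R\<^sub>0 \<omega> = 0\<close>, which breaks them. The bijection and the equivalence state
  that the correspondence is one-to-one.\<close>

theorem mainTheorem2:
  fixes M :: "'a measure" and N :: "'b measure" and N' :: "'c measure"
    and G :: "nat \<Rightarrow> 'a \<Rightarrow> real" and Q :: "'b \<Rightarrow> real" and Q' :: "'c \<Rightarrow> real"
    and m :: nat and r \<mu> k :: real and R R\<^sub>0 :: "'a \<Rightarrow> real"
  assumes "m \<ge> 2" and "r > 0" and "\<mu> > 0"
    and "prob_space M"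
    and "prob_space.indep_vars M (\<lambda>_. borel) G {1..m}"
    and "\<And>i. i \<in> {1..m} \<Longrightarrow> has_gamma_distribution M (G i) r \<mu>"
  defines "k \<equiv> (real m - 1) * r"
    and "R \<equiv> (\<lambda>\<omega>. G 1 \<omega> / (\<Sum>i = 1..m. G i \<omega>))"
    and "R\<^sub>0 \<equiv> (\<lambda>\<omega>. (real m - 1) * G 1 \<omega> / (\<Sum>i = 2..m. G i \<omega>))"
  assumes "prob_space N" and "has_snedecor_fisher_distribution N Q k r"
    and "prob_space N'" and "has_snedecor_fisher_distribution N' Q' r k"
  shows
    "(eq_in_distribution M R N (\<lambda>\<omega>. inverse (1 + k / r * Q \<omega>)) \<and>
      distributed M lborel R (\<lambda>x. ennreal (beta_density k r x))) \<and>
     (eq_in_distribution M R\<^sub>0 N' Q' \<and>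
      has_snedecor_fisher_distribution M R\<^sub>0 r k) \<and>
     ((AE \<omega> in M. 0 < R \<omega> \<and> R \<omega> < 1 \<and> 0 < R\<^sub>0 \<omega> \<and>
         R \<omega> = R\<^sub>0 \<omega> / (real m - 1 + R\<^sub>0 \<omega>) \<and>
         R\<^sub>0 \<omega> = (real m - 1) * R \<omega> / (1 - R \<omega>)) \<and>
      bij_betw (\<lambda>y. y / (real m - 1 + y)) {0<..} {0<..<1} \<and>
      (\<forall>x\<in>{0<..<1}. \<forall>y\<in>{0<..}.
         x = y / (real m - 1 + y) \<longleftrightarrow> y = (real m - 1) * x / (1 - x)))"
proof -
  interpret prob_space M by fact
  have k: "k > 0" and m1: "real m - 1 > 0" and rk: "k / r = real m - 1"
    using \<open>m \<ge> 2\<close> \<open>r > 0\<close> by (auto simp: k_def)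
  define X where "X = G 1"
  define S where "S = (\<lambda>\<omega>. \<Sum>i = 2..m. G i \<omega>)"
  have gamma: "distributed M lborel (G i) (gamma_density r \<mu>)" if "i \<in> {1..m}" for i
    using that assms by (intro has_gamma_distribution_imp_distributed) auto
  have X: "distributed M lborel X (gamma_density r \<mu>)"
    using gamma[of 1] \<open>m \<ge> 2\<close> by (simp add: X_def)
  have S: "distributed M lborel S (gamma_density k \<mu>)"
  proof -
    have "indep_vars (\<lambda>_. borel) G {2..m}"
      by (rule indep_vars_subset[OF assms(5)]) auto
    then have "distributed M lborel S (gamma_density (real (card {2..m}) * r) \<mu>)"
      unfolding S_def using assms(1-3) gamma by (intro distributed_gamma_sum) auto
    moreover have "real (card {2..m}) * r = k"
      using \<open>m \<ge> 2\<close> by (simp add: k_def of_nat_diff)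
    ultimately show ?thesis by simp
  qed
  \<comment> \<open>Separating the index 1 matches the form in which one member of an independent
    family is independent of the sum of the others.\<close>
  have split: "{1..m} = insert 1 {2..m}"
    using \<open>m \<ge> 2\<close> by auto
  have XS: "indep_var borel X borel S"
    unfolding X_def S_def using assms(5) by (intro indep_vars_sum) (simp_all only: split, simp_all)
  then have SX: "indep_var borel S borel X"
    by (rule indep_var_sym)
  have [measurable]: "X \<in> borel_measurable M" "S \<in> borel_measurable M"
    using distributed_measurable[OF X] distributed_measurable[OF S] by simp_all
  have R: "R = (\<lambda>\<omega>. X \<omega> / (X \<omega> + S \<omega>))"
    unfolding R_def X_def S_def split by simp
  have R0: "R\<^sub>0 = (\<lambda>\<omega>. k / r * (X \<omega> / S \<omega>))"
    by (simp add: R\<^sub>0_def X_def S_def rk)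
  have pos: "AE \<omega> in M. 0 < X \<omega> \<and> 0 < S \<omega>"
    using AE_pos_of_distributed_gamma_density[OF X] AE_pos_of_distributed_gamma_density[OF S] by simp

  have beta: "distributed M lborel R (beta_density k r)"
    unfolding R by (rule distributed_gamma_proportion[OF \<open>r > 0\<close> k \<open>\<mu> > 0\<close> X S XS])
  have fisher: "distributed M lborel R\<^sub>0 (snedecor_fisher_density r k)"
    unfolding R0 by (rule distributed_gamma_ratio[OF \<open>r > 0\<close> k \<open>\<mu> > 0\<close> X S XS])
  have Q: "distributed N lborel Q (snedecor_fisher_density k r)"
    and Q': "distributed N' lborel Q' (snedecor_fisher_density r k)"
    using assms by (simp_all add: has_snedecor_fisher_distribution_def)
  have [measurable]: "Q \<in> borel_measurable N" "Q' \<in> borel_measurable N'"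
      "R \<in> borel_measurable M" "R\<^sub>0 \<in> borel_measurable M"
    using distributed_measurable[OF Q] distributed_measurable[OF Q'] by (simp_all add: R R0)

  have "eq_in_distribution M R N (\<lambda>\<omega>. inverse (1 + k / r * Q \<omega>))"
  proof -
    let ?h = "\<lambda>x. inverse (1 + k / r * x)"
    \<comment> \<open>The inverse ratio has the law of Q, by the ratio lemma with the roles of X and
      S exchanged, and R = 1 / (1 + S / X) is the image of T under \<open>?h\<close>.\<close>
    define T where "T = (\<lambda>\<omega>. r / k * (S \<omega> / X \<omega>))"
    have [measurable]: "T \<in> borel_measurable M"
      by (simp add: T_def)
    have "distr M borel T = distr N borel Q"
      unfolding T_def
      by (rule distributed_eq_distr_borel[OF distributed_gamma_ratio[OF k \<open>r > 0\<close> \<open>\<mu> > 0\<close> S X SX] Q])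
    then have "distr (distr M borel T) borel ?h = distr (distr N borel Q) borel ?h"
      by simp
    then have "distr M borel (\<lambda>\<omega>. ?h (T \<omega>)) = distr N borel (\<lambda>\<omega>. ?h (Q \<omega>))"
      by (simp add: distr_distr comp_def)
    \<comment> \<open>The equality holds only where X is nonzero: at X = 0 division by zero yields 0
      for R and 1 for \<open>?h (T \<omega>)\<close>.\<close>
    moreover have "distr M borel R = distr M borel (\<lambda>\<omega>. ?h (T \<omega>))"
    proof (rule distr_cong_AE)
      show "AE \<omega> in M. R \<omega> = ?h (T \<omega>)"
        using pos
      proof eventually_elim
        case (elim \<omega>)
        have "k / r * T \<omega> = S \<omega> / X \<omega>"
          using k \<open>r > 0\<close> by (simp add: T_def)
        then show ?case
          using elim unfolding R by (subst \<open>k / r * T \<omega> = S \<omega> / X \<omega>\<close>) (simp add: field_simps)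
      qed
    qed simp_all
    ultimately show ?thesis
      by (simp add: eq_in_distribution_def)
  qed
  moreover have "eq_in_distribution M R\<^sub>0 N' Q'"
    using distributed_eq_distr_borel[OF fisher Q'] by (simp add: eq_in_distribution_def)
  moreover have "AE \<omega> in M. 0 < R \<omega> \<and> R \<omega> < 1 \<and> 0 < R\<^sub>0 \<omega> \<and>
         R \<omega> = R\<^sub>0 \<omega> / (real m - 1 + R\<^sub>0 \<omega>) \<and>
         R\<^sub>0 \<omega> = (real m - 1) * R \<omega> / (1 - R \<omega>)"
    using pos
  proof eventually_elim
    case (elim \<omega>)
    have R01: "0 < R \<omega>" "R \<omega> < 1" and R0_pos: "0 < R\<^sub>0 \<omega>"
      using elim m1 by (simp_all add: R R0 rk)
    \<comment> \<open>Only this direction is computed; the formula for R in terms of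
      \<open>R\<^sub>0\<close> follows from the equivalence.\<close>
    have "R\<^sub>0 \<omega> = (real m - 1) * R \<omega> / (1 - R \<omega>)"
    proof -
      have "1 - R \<omega> = S \<omega> / (X \<omega> + S \<omega>)"
        using elim by (simp add: R field_simps)
      then show ?thesis
        using elim by (simp add: R R0 rk)
    qed
    then show ?case
      using R01 R0_pos ratio_proportion_iff[OF m1 R0_pos R01(2)] by blast
  qed
  ultimately show ?thesis
    using beta fisher bij_betw_ratio_proportion[OF m1] ratio_proportion_iff[OF m1]
    by (simp add: has_snedecor_fisher_distribution_def)
qed

end
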